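(* Let $n\ge 1$. Let $\mathcal{K}^{n-1}\subset\mathbb{R}^n$ be the convex hull of the points $M(t)=(a_1b_1,\dots,a_nb_n)$, $t\in Y_n$, and let $\mathcal{P}^{n-1}\subset \mathbb{R}^n$ be the permutohedron, i.e. the convex hull of the points $M(\sigma)=(\sigma(1),\dots,\sigma(n))$, $\sigma\in S_n$. Then $\mathcal{K}^{n-1}$ contains $\mathcal{P}^{n-1}$, and for $\sigma\in S_n$ and $t\in Y_n$ the following are equivalent: (a) $M(\sigma)=M(t)$; (b) $\psi^{-1}(t)=\{\sigma\}$; (c) $\psi(\sigma)=t$ and for all $i$ (with $a_i,b_i$ computed in $t$) either $a_i=1$ or $b_i=1$; (d) $\psi(\sigma)=t$ and the permutation $\sigma$ has the following property: either $\sigma(1)=n$ or $\sigma(n)=n$, and the remaining permutation $\sigma'\in S_{n-1}$, obtained by deleting $n$ from the sequence $(\sigma(1),\dots,\sigma(n))$, satisfies the same property (recursively, until no entries are left).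
   Context: $Y_n$ is the set of planar rooted binary trees with $n+1$ leaves (so $n$ internal vertices, each having a left input and a right input). Label the leaves of $t\in Y_n$ from left to right by $0,1,\dots,n$, and the internal vertices by $1,\dots,n$ so that the $i$th vertex is the one which falls in between the leaves $i-1$ and $i$ (leaf $i-1$ is the rightmost leaf of its left subtree and leaf $i$ the leftmost leaf of its right subtree). The number $a_i$ (resp. $b_i$) is the number of leaves of the left (resp. right) subtree at the $i$th vertex. $S_n$ is the symmetric group on $\{1,\dots,n\}$. The surjective map $\psi:S_n\to Y_n$ is obtained by interpreting a permutation as a planar binary tree with levels and then forgetting the levels: in a planar binary tree with levels, each internal vertex has a level in $\{1,\dots,n\}$, there is exactly one vertex per level, and each vertex has a level larger than those of its descendants (so the root vertex has level $n$); the permutation corresponding to a leveled tree is $\sigma(i)=$ the level of the $i$th vertex. Equivalently, recursively: $\psi$ of the empty sequence is the tree $|$ with one leaf and no internal vertex; for a sequence of distinct integers whose maximum is at position $j$, $\psi$ of the sequence is the tree whose left subtree is $\psi$ of the entries before position $j$ and whose right subtree is $\psi$ of the entries after position $j$. *)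

theory Defs
  imports "HOL-Analysis.Analysis" "HOL-Combinatorics.Permutations" "HOL-Library.Tree"
begin

text \<open>
  Internal vertices of a planar rooted binary tree carry a label; the label type \<^typ>\<open>unit\<close>
  gives bare trees, and natural number labels are used as levels.
\<close>

definition PBT :: "nat \<Rightarrow> unit tree set" where
  "PBT n = {t. size1 t = n + 1}"

text \<open>
  The subtree rooted at the \<open>i\<close>th internal vertex, \<open>1 \<le> i \<le> size t\<close> (the value at \<^const>\<open>Leaf\<close> is
  junk).  In \<open>\<langle>l, x, r\<rangle>\<close> the leaves of \<open>l\<close> are \<open>0, \<dots>, size1 l - 1\<close> and those of \<open>r\<close> start
  at \<open>size1 l\<close>, so the root falls between the leaves \<open>size1 l - 1\<close> and \<open>size1 l\<close>.
\<close>

fun vertex :: "'a tree \<Rightarrow> nat \<Rightarrow> 'a tree" where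
  "vertex Leaf i = Leaf"
| "vertex (Node l x r) i =
    (if i < size1 l then vertex l i
     else if i = size1 l then Node l x r
     else vertex r (i - size1 l))"

definition left_leaves :: "'a tree \<Rightarrow> nat \<Rightarrow> nat" where
  "left_leaves t i = size1 (left (vertex t i))"

definition right_leaves :: "'a tree \<Rightarrow> nat \<Rightarrow> nat" where
  "right_leaves t i = size1 (right (vertex t i))"

definition Sym :: "nat \<Rightarrow> (nat \<Rightarrow> nat) set" where
  "Sym n = {\<sigma>. \<sigma> permutes {1..n}}"

definition seq :: "nat \<Rightarrow> (nat \<Rightarrow> nat) \<Rightarrow> nat list" where
  "seq n \<sigma> = map \<sigma> [1..<n + 1]"

text \<open>The tree with levels of a sequence of distinct levels: the root sits at the maximum.\<close>

function leveled_tree :: "nat list \<Rightarrow> nat tree" where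
  "leveled_tree xs =
    (if xs = [] then Leaf
     else let m = Max (set xs) in
       Node (leveled_tree (takeWhile (\<lambda>x. x \<noteq> m) xs)) m
            (leveled_tree (tl (dropWhile (\<lambda>x. x \<noteq> m) xs))))"
  by auto
termination
proof (relation "Wellfounded.measure length", goal_cases)
  case 1
  show ?case by simp
next
  case (2 xs m)
  then have "m \<in> set xs" by simp
  then have "takeWhile (\<lambda>x. x \<noteq> m) xs \<noteq> xs"
    by (metis (mono_tags) set_takeWhileD)
  then show ?case
    by (metis (no_types, lifting) in_measure le_neq_implies_less length_takeWhile_le takeWhile_eq_take
        take_all_iff order_refl)
next
  case (3 xs m)
  have "length (dropWhile (\<lambda>x. x \<noteq> m) xs) \<le> length xs"
    by (rule length_dropWhile_le)
  moreover have "length xs > 0" using 3 by simp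
  ultimately have "length (tl (dropWhile (\<lambda>x. x \<noteq> m) xs)) < length xs"
    unfolding length_tl by linarith
  then show ?case by simp
qed

declare leveled_tree.simps [simp del]

definition psi :: "nat \<Rightarrow> (nat \<Rightarrow> nat) \<Rightarrow> unit tree" where
  "psi n \<sigma> = map_tree (\<lambda>_. ()) (leveled_tree (seq n \<sigma>))"

text \<open>
  The coordinates of \<open>\<real>\<^sup>n\<close>, rendered as \<^typ>\<open>real ^ 'n\<close>, are numbered by a bijection \<open>pos\<close>
  from the index type onto \<open>{1..n}\<close>.
\<close>

definition M_tree :: "('n::finite \<Rightarrow> nat) \<Rightarrow> unit tree \<Rightarrow> real ^ 'n" where
  "M_tree pos t = (\<chi> k. real (left_leaves t (pos k) * right_leaves t (pos k)))"

definition M_perm :: "('n::finite \<Rightarrow> nat) \<Rightarrow> (nat \<Rightarrow> nat) \<Rightarrow> real ^ 'n" where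
  "M_perm pos \<sigma> = (\<chi> k. real (\<sigma> (pos k)))"

definition associahedron :: "('n::finite \<Rightarrow> nat) \<Rightarrow> nat \<Rightarrow> (real ^ 'n) set" where
  "associahedron pos n = convex hull (M_tree pos ` PBT n)"

definition permutohedron :: "('n::finite \<Rightarrow> nat) \<Rightarrow> nat \<Rightarrow> (real ^ 'n) set" where
  "permutohedron pos n = convex hull (M_perm pos ` Sym n)"

text \<open>The recursive property of a sequence which is an arrangement of \<open>1, \<dots>, n\<close>.\<close>

fun max_at_end :: "nat \<Rightarrow> nat list \<Rightarrow> bool" where
  "max_at_end 0 xs \<longleftrightarrow> True"
| "max_at_end (Suc m) xs \<longleftrightarrow>
    (hd xs = Suc m \<or> last xs = Suc m) \<and> max_at_end m (remove1 (Suc m) xs)"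

text \<open>
  The following facts identify \<^const>\<open>leveled_tree\<close> with the tree with levels that corresponds to
  a sequence: the level of the \<open>i\<close>th vertex is the \<open>i\<close>th entry, and a vertex has a larger level
  than its descendants.
\<close>

lemma inorder_leveled_tree: "inorder (leveled_tree xs) = xs"
proof (induction xs rule: leveled_tree.induct)
  case (1 xs)
  show ?case
  proof (cases "xs = []")
    case True
    then show ?thesis by (simp add: leveled_tree.simps)
  next
    case False
    define m where "m = Max (set xs)"
    have "m \<in> set xs" using False by (simp add: m_def)
    then have "dropWhile (\<lambda>x. x \<noteq> m) xs \<noteq> []"
      by (auto simp: dropWhile_eq_Nil_conv)
    then have "dropWhile (\<lambda>x. x \<noteq> m) xs = m # tl (dropWhile (\<lambda>x. x \<noteq> m) xs)"
      by (metis (mono_tags, lifting) hd_dropWhile list.collapse)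
    then have "takeWhile (\<lambda>x. x \<noteq> m) xs @ m # tl (dropWhile (\<lambda>x. x \<noteq> m) xs) = xs"
      by (metis (no_types, lifting) takeWhile_dropWhile_id)
    moreover have "leveled_tree xs = Node (leveled_tree (takeWhile (\<lambda>x. x \<noteq> m) xs)) m
        (leveled_tree (tl (dropWhile (\<lambda>x. x \<noteq> m) xs)))"
      using False by (subst leveled_tree.simps) (simp add: Let_def m_def)
    ultimately show ?thesis
      using 1[OF False m_def] by simp
  qed
qed

lemma value_vertex:
  "1 \<le> i \<Longrightarrow> i \<le> size t \<Longrightarrow> value (vertex t i) = inorder t ! (i - 1)"
proof (induction t arbitrary: i)
  case Leaf
  then show ?case by simp
next
  case (Node l x r)
  have "length (inorder l) = size l" by simp
  then show ?case
    using Node by (auto simp: nth_append nth_Cons' size1_size)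
qed

lemma value_vertex_leveled_tree:
  assumes "i \<in> {1..n}"
  shows "value (vertex (leveled_tree (seq n \<sigma>)) i) = \<sigma> i"
proof -
  have "size (leveled_tree (seq n \<sigma>)) = n"
    by (metis inorder_leveled_tree length_inorder length_map length_upt add_diff_cancel_right' seq_def)
  moreover have "seq n \<sigma> ! (i - 1) = \<sigma> i"
    using assms nth_map_upt[of "i - 1" "n + 1" 1 \<sigma>] by (auto simp: seq_def simp del: upt_Suc)
  ultimately show ?thesis
    using assms by (simp add: value_vertex inorder_leveled_tree)
qed

lemma leveled_tree_decreasing:
  assumes "distinct xs" "Node l m r \<in> subtrees (leveled_tree xs)"
    "y \<in> set_tree l \<union> set_tree r"
  shows "y < m"
  using assms
proof (induction xs rule: leveled_tree.induct)
  case (1 xs)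
  show ?case
  proof (cases "xs = []")
    case True
    then show ?thesis using 1 by (simp add: leveled_tree.simps)
  next
    case False
    define k where "k = Max (set xs)"
    define u where "u = takeWhile (\<lambda>x. x \<noteq> k) xs"
    define v where "v = tl (dropWhile (\<lambda>x. x \<noteq> k) xs)"
    have eq: "leveled_tree xs = Node (leveled_tree u) k (leveled_tree v)"
      using False by (subst leveled_tree.simps) (simp add: Let_def k_def u_def v_def)
    have xs: "xs = u @ k # v"
      using inorder_leveled_tree[of xs] by (simp add: eq inorder_leveled_tree)
    have st: "set_tree (leveled_tree ys) = set ys" for ys
      by (metis inorder_leveled_tree set_inorder)
    have d: "distinct u" "distinct v" using 1 xs by auto
    have less: "y < k" if "y \<in> set u \<union> set v" for y
    proof -
      have "y \<in> set xs" using that by (subst xs) auto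
      then have "y \<le> k" by (simp add: k_def)
      moreover have "y \<noteq> k" using that xs 1 by auto
      ultimately show ?thesis by simp
    qed
    note IH = 1(1)[OF False k_def, folded u_def] 1(2)[OF False k_def, folded v_def]
    show ?thesis
      using 1(4,5) IH(1)[OF d(1)] IH(2)[OF d(2)] less unfolding eq by (auto simp: st)
  qed
qed

lemma psi_in_PBT: "psi n \<sigma> \<in> PBT n"
proof -
  have "size (leveled_tree (seq n \<sigma>)) = n"
    by (metis inorder_leveled_tree length_inorder length_map length_upt add_diff_cancel_right' seq_def)
  then show ?thesis by (simp add: psi_def PBT_def size1_size)
qed

end

theory Submission
  imports Defs
begin

text \<open>
  The coordinates of \<open>M(t)\<close> over the vertices of a subtree with \<open>k\<close> vertices add up to
  \<open>k (k + 1) / 2\<close>, the least possible sum of \<open>k\<close> distinct positive integers.  Hence, if the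
  coordinates of \<open>M(t)\<close> are distinct, then those over each such subtree are \<open>1, \<dots>, k\<close>; so
  \<open>a b \<le> k = a + b - 1\<close> at its root, which forces \<open>a = 1\<close> or \<open>b = 1\<close> there.  For the inclusion of the
  polytopes, a linear functional \<open>w\<close> is minimised over the trees by the tree with the root at the
  minimum of \<open>w\<close>, and \<open>w\<close> is then, up to a constant function, a nonnegative combination of indicator
  functions of subtrees.  So this minimum bounds \<open>w\<close> from below on the permutohedron too.
\<close>

section \<open>Sums of distinct positive integers\<close>

text \<open>Induction adds the largest element \<open>b\<close>: then \<open>insert b A\<close> lies
  in \<open>{1..b}\<close>, so \<open>b\<close> is at least the new cardinality, which is exactly
  half of what \<open>card A * (card A + 1)\<close> gains.\<close>

lemma sum_positive_nats:
  fixes A :: "nat set"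
  assumes "finite A" "0 \<notin> A"
  shows "card A * (card A + 1) \<le> 2 * \<Sum>A"
    and "2 * \<Sum>A = card A * (card A + 1) \<Longrightarrow> A = {1..card A}"
proof -
  have "card A * (card A + 1) \<le> 2 * \<Sum>A \<and>
    (2 * \<Sum>A = card A * (card A + 1) \<longrightarrow> A = {1..card A})"
    using assms
  proof (induction A rule: finite_linorder_max_induct)
    case empty
    then show ?case by simp
  next
    case (insert b A)
    have b: "b \<notin> A" using insert by auto
    have "insert b A \<subseteq> {1..b}"
    proof
      fix x assume x: "x \<in> insert b A"
      then have "x \<noteq> 0" using insert.prems by metis
      then show "x \<in> {1..b}" using x insert.hyps(2) by auto
    qed
    then have "card (insert b A) \<le> b"
      using card_mono[of "{1..b}"] by fastforce
    then have le: "card A + 1 \<le> b" using insert.hyps b by simp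
    have IH: "card A * (card A + 1) \<le> 2 * \<Sum>A"
      "2 * \<Sum>A = card A * (card A + 1) \<longrightarrow> A = {1..card A}"
      using insert by auto
    have c: "card (insert b A) = card A + 1" "\<Sum>(insert b A) = b + \<Sum>A"
      using insert.hyps b by auto
    have eq: "(card A + 1) * (card A + 1 + 1) = card A * (card A + 1) + 2 * (card A + 1)"
      by (simp add: algebra_simps)
    show ?case
    proof (intro conjI impI)
      show "card (insert b A) * (card (insert b A) + 1) \<le> 2 * \<Sum>(insert b A)"
        unfolding c eq using IH(1) le add_mono[OF IH(1), of "2 * (card A + 1)" "2 * b"] by simp
    next
      assume "2 * \<Sum>(insert b A) = card (insert b A) * (card (insert b A) + 1)"
      then have "2 * b + 2 * \<Sum>A = card A * (card A + 1) + 2 * (card A + 1)"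
        unfolding c eq by (simp only: distrib_left)
      \<comment> \<open>Both summands on the left are at least their counterparts on the right, so
        equality of the totals forces equality in each.\<close>
      moreover have "p + q = r + s \<Longrightarrow> r \<le> q \<Longrightarrow> s \<le> p \<Longrightarrow> p = s \<and> q = r" for p q r s :: nat
        by linarith
      ultimately have "2 * b = 2 * (card A + 1) \<and> 2 * \<Sum>A = card A * (card A + 1)"
        using IH(1) le by (meson mult_le_mono2)
      then have "b = card A + 1" "2 * \<Sum>A = card A * (card A + 1)"
        by simp_all
      then show "insert b A = {1..card (insert b A)}"
        unfolding c using IH(2) by (metis Suc_eq_plus1 atLeastAtMostSuc_conv le_add2)
    qed
  qed
  then show "card A * (card A + 1) \<le> 2 * \<Sum>A"
    "2 * \<Sum>A = card A * (card A + 1) \<Longrightarrow> A = {1..card A}" by auto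
qed

lemma sum_list_positive_nats:
  fixes xs :: "nat list"
  assumes "distinct xs" "0 \<notin> set xs"
  shows "length xs * (length xs + 1) \<le> 2 * sum_list xs"
    and "2 * sum_list xs = length xs * (length xs + 1) \<Longrightarrow> set xs = {1..length xs}"
  using sum_positive_nats[of "set xs"] assms
  by (auto simp: distinct_card distinct_sum_list_conv_Sum)

section \<open>The coordinates of the point of a tree\<close>

text \<open>A list, so that it can be cut at the root of the tree; \<open>[1..<size1 t]\<close> runs
  over exactly the internal vertices, since \<open>size1 t = size t + 1\<close>.\<close>

definition loday :: "'a tree \<Rightarrow> nat list" where
  "loday t = map (\<lambda>i. left_leaves t i * right_leaves t i) [1..<size1 t]"

text \<open>Vertices of \<open>l\<close> keep their numbers, and those of \<open>r\<close> are
  shifted by \<open>size1 l\<close>, which \<open>vertex\<close> subtracts again. This turns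
  statements about numbered vertices into structural recursion.\<close>

lemma map_vertex_Node:
  "map (vertex (Node l x r)) [1..<size1 (Node l x r)] =
    map (vertex l) [1..<size1 l] @ Node l x r # map (vertex r) [1..<size1 r]"
proof -
  have pos: "1 \<le> size1 l" "1 \<le> size1 r" by (simp_all add: size1_size)
  have "map (\<lambda>i. i + size1 l) [1..<size1 r] = [Suc (size1 l)..<size1 l + size1 r]"
    by (rule nth_equalityI) auto
  then have "[1..<size1 l + size1 r] = [1..<size1 l] @ size1 l # map (\<lambda>i. i + size1 l) [1..<size1 r]"
    using pos upt_add_eq_append[of 1 "size1 l" "size1 r"] upt_conv_Cons[of "size1 l" "size1 l + size1 r"]
    by simp
  then show ?thesis by (auto simp: comp_def)
qed

lemma loday_conv_vertex:
  "loday t = map (\<lambda>s. size1 (left s) * size1 (right s)) (map (vertex t) [1..<size1 t])"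
  by (simp add: loday_def left_leaves_def right_leaves_def comp_def)

lemma loday_simps [simp]:
  "loday Leaf = []"
  "loday (Node l x r) = loday l @ size1 l * size1 r # loday r"
  by (simp add: loday_def) (unfold loday_conv_vertex map_vertex_Node, simp)

lemma length_loday [simp]: "length (loday t) = size t"
  by (simp add: loday_def size1_size del: upt_Suc)

lemma zero_notin_loday: "0 \<notin> set (loday t)"
  by (induction t) (auto simp: size1_size)

text \<open>With p and q vertices in the two subtrees, p(p+1) + q(q+1) + 2(p+1)(q+1) =
  (p+q+1)(p+q+2). Thus all points M(t) for one n lie in a common hyperplane.\<close>

lemma sum_loday: "2 * sum_list (loday t) = size t * (size t + 1)"
  by (induction t) (auto simp: size1_size algebra_simps)

text \<open>The leaf condition of (c) in recursive form: the internal vertices form a single path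
  down from the root.\<close>

fun chain :: "'a tree \<Rightarrow> bool" where
  "chain Leaf \<longleftrightarrow> True"
| "chain (Node l x r) \<longleftrightarrow> (l = Leaf \<or> r = Leaf) \<and> chain l \<and> chain r"

lemma chain_map_tree [simp]: "chain (map_tree f t) \<longleftrightarrow> chain t"
  by (induction t) auto

lemma chain_iff_leaves:
  "chain t \<longleftrightarrow> (\<forall>i\<in>{1..size t}. left_leaves t i = 1 \<or> right_leaves t i = 1)"
proof -
  have "chain t \<longleftrightarrow>
    (\<forall>s\<in>set (map (vertex t) [1..<size1 t]). size1 (left s) = 1 \<or> size1 (right s) = 1)"
  proof (induction t)
    case Leaf
    then show ?case by simp
  next
    case (Node l x r)
    have "size1 s = 1 \<longleftrightarrow> s = Leaf" for s :: "'a tree"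
      by (simp add: size1_size)
    then show ?case unfolding map_vertex_Node using Node by auto
  qed
  also have "\<dots> \<longleftrightarrow> (\<forall>i\<in>{1..size t}. left_leaves t i = 1 \<or> right_leaves t i = 1)"
    by (auto simp: left_leaves_def right_leaves_def size1_size)
  finally show ?thesis .
qed

section \<open>Trees of sequences\<close>

text \<open>\<open>psi\<close> for arbitrary sequences: the parts before and after the maximum are
  in general no longer arrangements of an initial segment.\<close>

abbreviation shape :: "nat list \<Rightarrow> unit tree" where
  "shape xs \<equiv> map_tree (\<lambda>_. ()) (leveled_tree xs)"

lemma leveled_tree_Nil [simp]: "leveled_tree [] = Leaf"
  by (simp add: leveled_tree.simps)

lemma leveled_tree_append_Cons:
  assumes "\<And>y. y \<in> set u \<union> set v \<Longrightarrow> y < m"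
  shows "leveled_tree (u @ m # v) = Node (leveled_tree u) m (leveled_tree v)"
proof -
  have "Max (set (u @ m # v)) = m"
    using assms by (intro Max_eqI) (auto simp: less_imp_le)
  moreover have "takeWhile (\<lambda>x. x \<noteq> m) (u @ m # v) = u" "dropWhile (\<lambda>x. x \<noteq> m) (u @ m # v) = m # v"
    using assms by (auto simp: takeWhile_append dropWhile_append)
  ultimately show ?thesis
    by (subst leveled_tree.simps) (simp add: Let_def)
qed

lemma shape_append_Cons:
  assumes "\<And>y. y \<in> set u \<union> set v \<Longrightarrow> y < m"
  shows "shape (u @ m # v) = Node (shape u) () (shape v)"
  using leveled_tree_append_Cons[OF assms] by simp

lemma size_leveled_tree [simp]: "size (leveled_tree xs) = length xs"
  by (metis inorder_leveled_tree length_inorder)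

lemma distinct_split_Max:
  fixes xs :: "nat list"
  assumes "distinct xs" "xs \<noteq> []"
  obtains u v where "xs = u @ Max (set xs) # v" "\<And>y. y \<in> set u \<union> set v \<Longrightarrow> y < Max (set xs)"
proof -
  obtain u v where xs: "xs = u @ Max (set xs) # v"
    using assms by (meson List.finite_set Max_in set_empty split_list)
  have "y < Max (set xs)" if y: "y \<in> set u \<union> set v" for y
  proof -
    have "y \<in> set xs" using y by (subst xs) auto
    then have "y \<le> Max (set xs)" by simp
    moreover have "y \<noteq> Max (set xs)"
      using y assms(1) xs by (metis UnE distinct.simps(2) distinct_append disjoint_iff list.set_intros(1))
    ultimately show ?thesis by simp
  qed
  with xs that show ?thesis by blast
qed

text \<open>For inductions on n: \<open>u\<close> and \<open>v\<close> separately need not be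
  arrangements of an initial segment, but their concatenation is one.\<close>

lemma arrangement_split_Max:
  fixes xs :: "nat list"
  assumes "distinct xs" "set xs = {1..Suc n}"
  obtains u v where "xs = u @ Suc n # v" "\<And>y. y \<in> set u \<union> set v \<Longrightarrow> y < Suc n"
    "distinct (u @ v)" "set (u @ v) = {1..n}"
proof -
  have ne: "xs \<noteq> []" using assms by auto
  have M: "Max (set xs) = Suc n" unfolding assms by (intro Max_eqI) auto
  obtain u v where uv: "xs = u @ Suc n # v" "\<And>y. y \<in> set u \<union> set v \<Longrightarrow> y < Suc n"
    using distinct_split_Max[OF assms(1) ne] unfolding M by metis
  have "distinct (u @ v)" using assms(1) uv(1) by simp
  moreover have "set (u @ v) = set xs - {Suc n}"
    using assms(1) unfolding uv(1) by auto
  moreover have "{1..Suc n} - {Suc n} = {1..n}" by auto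
  ultimately have "distinct (u @ v)" "set (u @ v) = {1..n}" by (simp_all only: assms(2))
  then show ?thesis by (intro that[OF uv(1)] uv(2))
qed

text \<open>\<open>Suc n\<close> stands first iff \<open>u\<close> is empty, and last iff
  \<open>v\<close> is. In either case \<open>u @ v\<close> is the only remaining part, so the
  induction hypothesis speaks of the one subtree left. This relates (c) and (d).\<close>

lemma chain_leveled_tree_iff_max_at_end:
  assumes "distinct xs" "set xs = {1..n}"
  shows "chain (leveled_tree xs) \<longleftrightarrow> max_at_end n xs"
  using assms
proof (induction n arbitrary: xs)
  case 0
  then show ?case by simp
next
  case (Suc n)
  obtain u v where xs: "xs = u @ Suc n # v" and less: "\<And>y. y \<in> set u \<union> set v \<Longrightarrow> y < Suc n"
    and d: "distinct (u @ v)" "set (u @ v) = {1..n}"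
    using arrangement_split_Max[OF Suc.prems] by metis
  have notin: "Suc n \<notin> set u" "Suc n \<notin> set v" using less by blast+
  have hd: "hd xs = Suc n \<longleftrightarrow> u = []" using notin xs by (cases u) auto
  have last: "last xs = Suc n \<longleftrightarrow> v = []"
    using notin xs by (auto dest: last_in_set)
  have rem: "remove1 (Suc n) xs = u @ v" using notin xs by (simp add: remove1_append)
  have lt: "leveled_tree xs = Node (leveled_tree u) (Suc n) (leveled_tree v)"
    unfolding xs by (rule leveled_tree_append_Cons[OF less])
  have leaf: "leveled_tree ys = Leaf \<longleftrightarrow> ys = []" for ys
    by (metis inorder.simps(1) inorder_leveled_tree leveled_tree_Nil)
  show ?case
    using Suc.IH[OF d] unfolding lt chain.simps leaf max_at_end.simps hd last rem by auto
qed

text \<open>One of the two parts is empty, so the root coordinate is 1 times n + 1, which is the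
  level of the root; induction handles the rest. Hence a chain admits only one arrangement of
  levels.\<close>

lemma chain_shape_determines:
  assumes "distinct xs" "set xs = {1..n}" "chain (leveled_tree xs)"
  shows "xs = loday (shape xs)"
  using assms
proof (induction n arbitrary: xs)
  case 0
  then show ?case by simp
next
  case (Suc n)
  obtain u v where xs: "xs = u @ Suc n # v" and less: "\<And>y. y \<in> set u \<union> set v \<Longrightarrow> y < Suc n"
    and d: "distinct (u @ v)" "set (u @ v) = {1..n}"
    using arrangement_split_Max[OF Suc.prems(1,2)] by metis
  have lt: "leveled_tree xs = Node (leveled_tree u) (Suc n) (leveled_tree v)"
    unfolding xs by (rule leveled_tree_append_Cons[OF less])
  have "length (u @ v) = n" using d by (metis card_atLeastAtMost diff_Suc_1 distinct_card)
  moreover have "u = [] \<or> v = []"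
    using Suc.prems(3) lt by (auto) (metis inorder.simps(1) inorder_leveled_tree)+
  moreover have "loday (shape xs) =
      loday (shape u) @ Suc (length u) * Suc (length v) # loday (shape v)"
    unfolding lt by (simp add: size1_size)
  moreover have "chain (leveled_tree u)" "chain (leveled_tree v)" using Suc.prems(3) lt by auto
  ultimately show ?case
    using Suc.IH[OF d] xs by auto
qed

text \<open>The root carries the maximum of \<open>A\<close>; below it any split of the rest into
  sets of the right sizes will do.\<close>

lemma shape_surj:
  assumes "finite A" "card A = size t"
  shows "\<exists>xs. distinct xs \<and> set xs = A \<and> shape xs = t"
  using assms
proof (induction t arbitrary: A)
  case Leaf
  then show ?case by (auto intro: exI[of _ "[]"])
next
  case (Node l x r)
  define m where "m = Max A"
  have m: "m \<in> A" using Node.prems by (auto simp: m_def intro!: Max_in)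
  then have "card (A - {m}) = size l + size r" using Node.prems by simp
  then obtain B where B: "B \<subseteq> A - {m}" "card B = size l" "finite B"
    by (metis le_add1 obtain_subset_with_card_n)
  then have "card (A - {m} - B) = size r"
    using \<open>card (A - {m}) = _\<close> by (simp add: card_Diff_subset)
  then obtain v where v: "distinct v" "set v = A - {m} - B" "shape v = r"
    using Node.IH(2)[of "A - {m} - B"] Node.prems(1) by auto
  obtain u where u: "distinct u" "set u = B" "shape u = l"
    using Node.IH(1)[of B] B by auto
  have "y < m" if "y \<in> set u \<union> set v" for y
  proof -
    have "y \<in> A" "y \<noteq> m" using that u v B by auto
    then show ?thesis using Node.prems(1) by (simp add: m_def order_neq_le_trans)
  qed
  then have "shape (u @ m # v) = Node l x r"
    using u v by (subst shape_append_Cons) auto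
  moreover have "distinct (u @ m # v)" "set (u @ m # v) = A" using u v B m by auto
  ultimately show ?case by blast
qed

text \<open>A vertex with two internal children leaves a choice of which levels go left. If such a
  vertex lies deeper, two arrangements of that subtree are completed by a common arrangement of the
  other.\<close>

lemma shape_not_inj:
  assumes "finite A" "card A = size t" "\<not> chain t"
  shows "\<exists>xs ys. distinct xs \<and> set xs = A \<and> shape xs = t \<and>
    distinct ys \<and> set ys = A \<and> shape ys = t \<and> xs \<noteq> ys"
  using assms
proof (induction t arbitrary: A)
  case Leaf
  then show ?case by simp
next
  case (Node l x r)
  define m where "m = Max A"
  have m: "m \<in> A" using Node.prems by (auto simp: m_def intro!: Max_in)
  then have cA: "card (A - {m}) = size l + size r" using Node.prems by simp
  then obtain B where B: "B \<subseteq> A - {m}" "card B = size l" "finite B"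
    by (metis le_add1 obtain_subset_with_card_n)
  have cC: "card (A - {m} - B) = size r"
    using cA B by (simp add: card_Diff_subset)
  have fC: "finite (A - {m} - B)" using Node.prems(1) by auto
  have glue: "distinct (u @ m # v) \<and> set (u @ m # v) = A \<and> shape (u @ m # v) = Node l x r"
    if "distinct u" "distinct v" "shape u = l" "shape v = r" "set u \<subseteq> A - {m}"
      "set v = A - {m} - set u" for u v
  proof -
    have "y < m" if "y \<in> set u \<union> set v" for y
    proof -
      have "y \<in> A" "y \<noteq> m" using that \<open>set u \<subseteq> _\<close> \<open>set v = _\<close> by auto
      then show ?thesis using Node.prems(1) by (simp add: m_def order_neq_le_trans)
    qed
    then have "shape (u @ m # v) = Node l x r"
      using that by (subst shape_append_Cons) auto
    then show ?thesis using that m by auto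
  qed
  obtain u where u: "distinct u" "set u = B" "shape u = l"
    using shape_surj[of B l] B by auto
  obtain v where v: "distinct v" "set v = A - {m} - B" "shape v = r"
    using shape_surj[OF fC cC] by auto
  consider "\<not> chain l" | "\<not> chain r" | "l \<noteq> Leaf" "r \<noteq> Leaf"
    using Node.prems(3) by auto
  then show ?case
  proof cases
    case 1
    obtain p q where pq: "distinct p" "set p = B" "shape p = l"
      "distinct q" "set q = B" "shape q = l" "p \<noteq> q"
      using Node.IH(1)[OF B(3,2) 1] by blast
    have "p @ m # v \<noteq> q @ m # v" using pq(7) by simp
    moreover note glue[of p v] glue[of q v]
    ultimately show ?thesis using pq v B(1) by metis
  next
    case 2
    obtain p q where pq: "distinct p" "set p = A - {m} - B" "shape p = r"
      "distinct q" "set q = A - {m} - B" "shape q = r" "p \<noteq> q"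
      using Node.IH(2)[OF fC cC 2] by blast
    have "u @ m # p \<noteq> u @ m # q" using pq(7) by simp
    moreover note glue[of u p] glue[of u q]
    ultimately show ?thesis using pq u B(1) by metis
  next
    case 3
    then have "B \<noteq> {}" "A - {m} - B \<noteq> {}"
      using B cC by (metis card.empty eq_size_0)+
    then obtain b c where bc: "b \<in> B" "c \<in> A - {m} - B" by blast
    \<comment> \<open>Exchanging \<open>b\<close> for \<open>c\<close> changes the set of levels on
      the left but not its size.\<close>
    define B' where "B' = insert c (B - {b})"
    have B': "B' \<subseteq> A - {m}" "finite B'" using bc B by (auto simp: B'_def)
    have "c \<notin> B - {b}" using bc by simp
    then have "card B' = Suc (card (B - {b}))"
      using B(3) by (simp add: B'_def)
    then have cB': "card B' = size l"
      using card_Suc_Diff1[OF B(3) bc(1)] B(2) by simp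
    then have cC': "card (A - {m} - B') = size r"
      using cA B' by (simp add: card_Diff_subset)
    have fC': "finite (A - {m} - B')" using Node.prems(1) by auto
    obtain p where p: "distinct p" "set p = B'" "shape p = l"
      using shape_surj[OF B'(2) cB'] by blast
    obtain q where q: "distinct q" "set q = A - {m} - B'" "shape q = r"
      using shape_surj[OF fC' cC'] by blast
    \<comment> \<open>Equal lengths align the two lists at \<open>m\<close>, so equality of the
      whole lists would give \<open>u = p\<close>.\<close>
    have "length u = length p"
      using u(3) p(3) by (metis size_leveled_tree size_map_tree)
    moreover have "set u \<noteq> set p" using u p bc by (auto simp: B'_def)
    ultimately have "u @ m # v \<noteq> p @ m # q" by auto
    moreover note glue[of u v] glue[of p q]
    ultimately show ?thesis using p q u v B(1) B'(1) by metis
  qed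
qed

text \<open>The root coordinate turns out to be the maximum, so the sequence of coordinates splits
  at its maximum exactly where the tree splits at its root. This is the step from (a) to
  (c).\<close>

lemma distinct_loday:
  assumes "distinct (loday t)"
  shows "chain t \<and> shape (loday t) = t"
  using assms
proof (induction t)
  case Leaf
  then show ?case by simp
next
  case (Node l x r)
  have S: "set (loday (Node l x r)) = {1..size (Node l x r)}"
    using sum_list_positive_nats(2)[OF Node.prems zero_notin_loday] sum_loday[of "Node l x r"]
    by (simp del: loday_simps)
  then have "size1 l * size1 r \<le> size l + size r + 1" by auto
  \<comment> \<open>Expanding (p+1)(q+1) \<le> p+q+1 leaves pq \<le> 0.\<close>
  then have "size l * size r = 0" by (simp add: size1_size algebra_simps)
  then have one: "l = Leaf \<or> r = Leaf" by simp
  then have top: "size1 l * size1 r = size l + size r + 1" by (auto simp: size1_size)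
  have "y < size1 l * size1 r" if y: "y \<in> set (loday l) \<union> set (loday r)" for y
  proof -
    have "y \<in> {1..size l + size r + 1}" using y S by auto
    moreover have "y \<noteq> size1 l * size1 r" using y Node.prems by auto
    ultimately show ?thesis using top by auto
  qed
  then have "shape (loday (Node l x r)) = Node (shape (loday l)) () (shape (loday r))"
    unfolding loday_simps by (rule shape_append_Cons)
  then show ?case using Node one by auto
qed

section \<open>Permutations as sequences\<close>

lemma seq_arrangement:
  assumes "\<sigma> \<in> Sym n"
  shows "distinct (seq n \<sigma>)" "set (seq n \<sigma>) = {1..n}"
proof -
  have p: "\<sigma> permutes {1..n}" using assms by (simp add: Sym_def)
  then show "distinct (seq n \<sigma>)"
    by (auto simp: seq_def distinct_map intro: inj_on_subset[OF permutes_inj] simp del: upt_Suc)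
  have "{1..<n + 1} = {1..n}" by auto
  then show "set (seq n \<sigma>) = {1..n}"
    using permutes_image[OF p] by (simp add: seq_def del: upt_Suc)
qed

lemma seq_inj:
  assumes "\<sigma> \<in> Sym n" "\<tau> \<in> Sym n" "seq n \<sigma> = seq n \<tau>"
  shows "\<sigma> = \<tau>"
proof
  fix i
  show "\<sigma> i = \<tau> i"
  proof (cases "i \<in> {1..n}")
    case True
    then show ?thesis using assms(3) by (auto simp: seq_def simp del: upt_Suc)
  next
    case False
    then show ?thesis using assms(1,2) by (auto simp: Sym_def permutes_def)
  qed
qed

lemma seq_surj:
  assumes "distinct xs" "set xs = {1..n}"
  obtains \<sigma> where "\<sigma> \<in> Sym n" "seq n \<sigma> = xs"
proof -
  \<comment> \<open>List positions start at 0, hence \<open>i - 1\<close>; outside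
    \<open>{1..n}\<close> the identity is what \<open>permutes\<close> demands.\<close>
  define \<sigma> where "\<sigma> i = (if i \<in> {1..n} then xs ! (i - 1) else i)" for i
  have len: "length xs = n" using assms by (metis card_atLeastAtMost diff_Suc_1 distinct_card)
  have seq: "seq n \<sigma> = xs"
    using len by (intro nth_equalityI) (auto simp: seq_def \<sigma>_def simp del: upt_Suc)
  have "\<sigma> ` {1..n} = {1..n}"
  proof -
    have "{1..<n + 1} = {1..n}" by auto
    then have "\<sigma> ` {1..n} = set (seq n \<sigma>)" by (simp add: seq_def del: upt_Suc)
    then show ?thesis using seq assms by simp
  qed
  then have "bij_betw \<sigma> {1..n} {1..n}"
    by (simp add: bij_betw_def eq_card_imp_inj_on)
  then have "\<sigma> permutes {1..n}"
    by (rule bij_imp_permutes) (simp only: \<sigma>_def if_False)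
  then show ?thesis using that seq by (simp add: Sym_def)
qed

section \<open>The inclusion of the permutohedron\<close>

text \<open>Write w - c = (w - d) + (d - c). The correction depends only on the sum of the entries,
  so a shift of the weights is controlled by comparing sums.\<close>

lemma sum_list_zip_const_diff:
  fixes xs :: "nat list" and ws :: "real list"
  assumes "length ws = length xs"
  shows "(\<Sum>(w, x)\<leftarrow>zip ws xs. (w - c) * real x) =
    (\<Sum>(w, x)\<leftarrow>zip ws xs. (w - d) * real x) + (d - c) * real (sum_list xs)"
  using assms by (induction ws xs rule: list_induct2) (auto simp: algebra_simps)

text \<open>The root goes where the weight takes its minimum d: with weights w - d its term
  vanishes, and both sides are handled by induction with the new lower bound d. Distinctness and
  positivity pass to the parts of \<open>xs\<close>, while being a permutation would not.\<close>

lemma exists_tree_below: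
  fixes xs :: "nat list" and ws :: "real list"
  assumes "length ws = length xs" "distinct xs" "0 \<notin> set xs" "\<And>w. w \<in> set ws \<Longrightarrow> c \<le> w"
  shows "\<exists>t :: unit tree. size t = length xs \<and>
    (\<Sum>(w, x)\<leftarrow>zip ws (loday t). (w - c) * real x) \<le> (\<Sum>(w, x)\<leftarrow>zip ws xs. (w - c) * real x)"
  using assms
proof (induction "length ws" arbitrary: ws xs c rule: less_induct)
  case less
  show ?case
  proof (cases "ws = []")
    case True
    then show ?thesis using less.prems by (auto intro: exI[of _ Leaf])
  next
    case False
    define d where "d = Min (set ws)"
    have d: "d \<in> set ws" "\<And>w. w \<in> set ws \<Longrightarrow> d \<le> w" using False by (auto simp: d_def)
    then obtain w1 w2 where ws: "ws = w1 @ d # w2" by (meson split_list)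
    define x1 x x2 where "x1 = take (length w1) xs" and "x = xs ! length w1"
      and "x2 = drop (Suc (length w1)) xs"
    have lt: "length w1 < length xs" using less.prems(1) ws by simp
    have xs: "xs = x1 @ x # x2"
      using lt by (simp add: x1_def x_def x2_def id_take_nth_drop)
    have len: "length w1 = length x1" "length w2 = length x2"
      using less.prems(1) ws lt by (auto simp: x1_def x2_def)
    obtain l :: "unit tree" where l: "size l = length x1"
      "(\<Sum>(w, x)\<leftarrow>zip w1 (loday l). (w - d) * real x) \<le> (\<Sum>(w, x)\<leftarrow>zip w1 x1. (w - d) * real x)"
      using less.hyps[of w1 x1 d] len less.prems(2,3) d(2) ws xs by auto
    obtain r :: "unit tree" where r: "size r = length x2"
      "(\<Sum>(w, x)\<leftarrow>zip w2 (loday r). (w - d) * real x) \<le> (\<Sum>(w, x)\<leftarrow>zip w2 x2. (w - d) * real x)"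
      using less.hyps[of w2 x2 d] len less.prems(2,3) d(2) ws xs by auto
    define t where "t = Node l () r"
    have size: "size t = length xs" using l r by (simp add: t_def xs)
    have "(\<Sum>(w, x)\<leftarrow>zip ws (loday t). (w - d) * real x) \<le> (\<Sum>(w, x)\<leftarrow>zip ws xs. (w - d) * real x)"
      using l r len by (simp add: t_def ws xs)
    \<comment> \<open>Returning from d to c adds d - c \<ge> 0 times the sum of the entries, and
      that sum is the least possible for a tree.\<close>
    moreover have "(d - c) * real (sum_list (loday t)) \<le> (d - c) * real (sum_list xs)"
    proof (rule mult_left_mono)
      have "2 * sum_list (loday t) \<le> 2 * sum_list xs"
        unfolding sum_loday size by (rule sum_list_positive_nats(1)[OF less.prems(2,3)])
      then show "real (sum_list (loday t)) \<le> real (sum_list xs)" by simp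
    qed (use d(1) less.prems(4) in auto)
    moreover have "length ws = length (loday t)" using size less.prems(1) by simp
    ultimately have "(\<Sum>(w, x)\<leftarrow>zip ws (loday t). (w - c) * real x)
        \<le> (\<Sum>(w, x)\<leftarrow>zip ws xs. (w - c) * real x)"
      using sum_list_zip_const_diff[of ws "loday t" c d] sum_list_zip_const_diff[of ws xs c d]
        less.prems(1) by simp
    then show ?thesis using size by blast
  qed
qed

text \<open>Finiteness makes the hull compact, hence closed, as strict separation requires. The
  induction bounds the size instead of fixing it, so that both subtrees come from one set.\<close>

lemma finite_PBT: "finite (PBT n)"
proof -
  have "finite {t :: unit tree. size t \<le> k}" for k
  proof (induction k)
    case 0
    have "{t :: unit tree. size t \<le> 0} = {Leaf}" by auto
    then show ?case by simp
  next
    case (Suc k)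
    let ?T = "{t :: unit tree. size t \<le> k}"
    have "{t :: unit tree. size t \<le> Suc k} \<subseteq> insert Leaf ((\<lambda>(l, r). Node l () r) ` (?T \<times> ?T))"
    proof
      fix t :: "unit tree"
      assume "t \<in> {t. size t \<le> Suc k}"
      then show "t \<in> insert Leaf ((\<lambda>(l, r). Node l () r) ` (?T \<times> ?T))"
        by (cases t) auto
    qed
    then show ?case using Suc by (meson finite_SigmaI finite_imageI finite_insert finite_subset)
  qed
  then show ?thesis by (rule rev_finite_subset[of "{t. size t \<le> n}"]) (auto simp: PBT_def size1_size)
qed

text \<open>Carries inner products over to lists, where the numbering of the vertices replaces the
  index type.\<close>

lemma sum_over_positions:
  assumes "bij_betw pos (UNIV :: 'n::finite set) {1..n}"
  shows "(\<Sum>k\<in>UNIV. a $ k * f (pos k)) =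
    (\<Sum>(w, x)\<leftarrow>zip (map (\<lambda>i. a $ inv pos i) [1..<n + 1]) (map f [1..<n + 1]). w * (x :: real))"
proof -
  have inj: "inj pos" using assms by (simp add: bij_betw_def)
  have "(\<Sum>k\<in>UNIV. a $ k * f (pos k)) = (\<Sum>k\<in>UNIV. (\<lambda>i. a $ inv pos i * f i) (pos k))"
    by (simp add: inv_f_f[OF inj])
  also have "\<dots> = (\<Sum>i\<in>{1..n}. a $ inv pos i * f i)"
    by (rule sum.reindex_bij_betw[OF assms])
  also have "\<dots> = (\<Sum>i\<leftarrow>[1..<n + 1]. a $ inv pos i * f i)"
    by (simp add: sum_set_upt_conv_sum_list_nat[symmetric] atLeastLessThanSuc_atLeastAtMost
        del: upt_Suc)
  finally show ?thesis
    by (simp add: zip_map_map zip_same_conv_map comp_def del: upt_Suc)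
qed

text \<open>By convexity only the points M(\<sigma>) matter. One outside the closed hull would be
  strictly separated from it by some functional \<open>a\<close>, but some tree has a value under
  \<open>a\<close> that is no larger.\<close>

lemma permutohedron_subset_associahedron:
  fixes pos :: "'n::finite \<Rightarrow> nat"
  assumes bij: "bij_betw pos UNIV {1..n}"
  shows "permutohedron pos n \<subseteq> associahedron pos n"
  unfolding permutohedron_def
proof (rule hull_minimal)
  show "convex (associahedron pos n)" by (simp add: associahedron_def)
  show "M_perm pos ` Sym n \<subseteq> associahedron pos n"
  proof (rule ccontr)
    assume "\<not> ?thesis"
    then obtain \<sigma> where \<sigma>: "\<sigma> \<in> Sym n" "M_perm pos \<sigma> \<notin> associahedron pos n" by blast
    have "closed (associahedron pos n)"
      unfolding associahedron_def
      by (intro compact_imp_closed finite_imp_compact_convex_hull finite_imageI finite_PBT)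
    then obtain a b where ab: "a \<bullet> M_perm pos \<sigma> < b" "\<And>x. x \<in> associahedron pos n \<Longrightarrow> b < a \<bullet> x"
      using separating_hyperplane_closed_point[OF \<open>convex _\<close> _ \<sigma>(2)] by blast
    define ws where "ws = map (\<lambda>i. a $ inv pos i) [1..<n + 1]"
    \<comment> \<open>Any lower bound of the weights serves; inserting 0 ensures a nonempty
      set.\<close>
    define c where "c = Min (insert 0 (set ws))"
    have ca: "c \<le> w" if "w \<in> set ws" for w using that by (simp add: c_def)
    have len: "length ws = length (seq n \<sigma>)" by (simp add: ws_def seq_def)
    note arr = seq_arrangement[OF \<sigma>(1)]
    have pos: "0 \<notin> set (seq n \<sigma>)" using arr by simp
    obtain t :: "unit tree" where t: "size t = length (seq n \<sigma>)"
      "(\<Sum>(w, x)\<leftarrow>zip ws (loday t). (w - c) * real x) \<le> (\<Sum>(w, x)\<leftarrow>zip ws (seq n \<sigma>). (w - c) * real x)"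
      using exists_tree_below[OF len arr(1) pos ca] by blast
    have n: "size t = n" using t by (simp add: seq_def)
    have tP: "t \<in> PBT n" using n by (simp add: PBT_def size1_size)
    \<comment> \<open>Both sums are n(n+1)/2, so the shift by \<open>c\<close> cancels and the
      inequality holds for the weights themselves.\<close>
    have "2 * sum_list (loday t) = 2 * sum_list (seq n \<sigma>)"
    proof -
      have "sum_list (seq n \<sigma>) = \<Sum>{1..n}" using arr by (simp add: distinct_sum_list_conv_Sum)
      then show ?thesis using sum_loday[of t] n gauss_sum_from_Suc_0[of n, where 'a = nat]
        by (simp add: double_gauss_sum_from_Suc_0)
    qed
    then have "(\<Sum>(w, x)\<leftarrow>zip ws (loday t). w * real x) \<le> (\<Sum>(w, x)\<leftarrow>zip ws (seq n \<sigma>). w * real x)"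
      using t(2) sum_list_zip_const_diff[of ws "loday t" 0 c] sum_list_zip_const_diff[of ws "seq n \<sigma>" 0 c]
        len t(1) by simp
    moreover have "a \<bullet> M_tree pos t = (\<Sum>(w, x)\<leftarrow>zip ws (loday t). w * real x)"
      using sum_over_positions[OF bij, of a "\<lambda>i. real (left_leaves t i * right_leaves t i)"]
      by (simp add: inner_vec_def M_tree_def ws_def loday_def n size1_size zip_map_map
          comp_def case_prod_unfold del: upt_Suc)
    moreover have "a \<bullet> M_perm pos \<sigma> = (\<Sum>(w, x)\<leftarrow>zip ws (seq n \<sigma>). w * real x)"
      using sum_over_positions[OF bij, of a "\<lambda>i. real (\<sigma> i)"]
      by (simp add: inner_vec_def M_perm_def ws_def seq_def zip_map_map
          comp_def case_prod_unfold del: upt_Suc)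
    moreover have "b < a \<bullet> M_tree pos t"
      using tP ab(2) by (auto simp: associahedron_def intro: hull_inc)
    ultimately show False using ab(1) by simp
  qed
qed

section \<open>The equivalence of the four conditions\<close>

lemma M_perm_eq_M_tree_iff:
  assumes "bij_betw pos UNIV {1..n}" "size t = n"
  shows "M_perm pos \<sigma> = M_tree pos t \<longleftrightarrow> seq n \<sigma> = loday t"
proof -
  have "M_perm pos \<sigma> = M_tree pos t \<longleftrightarrow>
    (\<forall>k. \<sigma> (pos k) = left_leaves t (pos k) * right_leaves t (pos k))"
    by (simp add: M_perm_def M_tree_def vec_eq_iff del: of_nat_mult)
  also have "\<dots> \<longleftrightarrow> (\<forall>i\<in>range pos. \<sigma> i = left_leaves t i * right_leaves t i)" by blast
  also have "range pos = set [1..<n + 1]" using assms(1) by (auto simp: bij_betw_def)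
  finally show ?thesis using assms(2) by (simp add: seq_def loday_def size1_size del: upt_Suc)
qed

theorem proposition1p2:
  fixes n :: nat and pos :: "'n::finite \<Rightarrow> nat"
  assumes "n \<ge> 1"
    and "bij_betw pos (UNIV :: 'n set) {1..n}"
  shows "permutohedron pos n \<subseteq> associahedron pos n \<and>
    (\<forall>\<sigma>\<in>Sym n. \<forall>t\<in>PBT n.
      (M_perm pos \<sigma> = M_tree pos t \<longleftrightarrow> {\<tau>\<in>Sym n. psi n \<tau> = t} = {\<sigma>}) \<and>
      ({\<tau>\<in>Sym n. psi n \<tau> = t} = {\<sigma>} \<longleftrightarrow>
        psi n \<sigma> = t \<and> (\<forall>i\<in>{1..n}. left_leaves t i = 1 \<or> right_leaves t i = 1)) \<and>
      (psi n \<sigma> = t \<and> (\<forall>i\<in>{1..n}. left_leaves t i = 1 \<or> right_leaves t i = 1) \<longleftrightarrow>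
        psi n \<sigma> = t \<and> max_at_end n (seq n \<sigma>)))"
proof (rule conjI[OF permutohedron_subset_associahedron[OF assms(2)]], intro ballI)
  fix \<sigma> t
  assume \<sigma>: "\<sigma> \<in> Sym n" and "t \<in> PBT n"
  then have t: "size t = n" by (simp add: PBT_def size1_size)
  have leaves: "(\<forall>i\<in>{1..n}. left_leaves t i = 1 \<or> right_leaves t i = 1) \<longleftrightarrow> chain t"
    using chain_iff_leaves[of t] t by simp
  \<comment> \<open>Over a chain the tree determines the permutation: this gives (a) from (c), and
    uniqueness in (b).\<close>
  have chain_seq: "seq n \<tau> = loday t" if "\<tau> \<in> Sym n" "psi n \<tau> = t" "chain t" for \<tau>
    using chain_shape_determines[OF seq_arrangement[OF that(1)]] that by (auto simp: psi_def)
  \<comment> \<open>Conditions (a), (b) and (d) are each compared with (c), in the form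
    \<open>psi n \<sigma> = t \<and> chain t\<close>.\<close>
  have ac: "M_perm pos \<sigma> = M_tree pos t \<longleftrightarrow> psi n \<sigma> = t \<and> chain t"
    unfolding M_perm_eq_M_tree_iff[OF assms(2) t]
  proof
    assume eq: "seq n \<sigma> = loday t"
    then show "psi n \<sigma> = t \<and> chain t"
      using distinct_loday[of t] seq_arrangement(1)[OF \<sigma>] by (simp add: psi_def)
  qed (use chain_seq \<sigma> in blast)
  have bc: "{\<tau>\<in>Sym n. psi n \<tau> = t} = {\<sigma>} \<longleftrightarrow> psi n \<sigma> = t \<and> chain t"
  proof
    assume fibre: "{\<tau>\<in>Sym n. psi n \<tau> = t} = {\<sigma>}"
    have "chain t"
    proof (rule ccontr)
      assume "\<not> chain t"
      \<comment> \<open>Two arrangements with the same tree yield two permutations in a fibre that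
        is a singleton.\<close>
      then obtain xs ys where *: "distinct xs" "set xs = {1..n}" "shape xs = t"
        "distinct ys" "set ys = {1..n}" "shape ys = t" "xs \<noteq> ys"
        using shape_not_inj[of "{1..n}" t] t by auto
      obtain \<rho> \<tau> where "\<rho> \<in> Sym n" "seq n \<rho> = xs" "\<tau> \<in> Sym n" "seq n \<tau> = ys"
        using seq_surj[OF *(1,2)] seq_surj[OF *(4,5)] by metis
      then have "\<rho> \<in> {\<sigma>}" "\<tau> \<in> {\<sigma>}" "\<rho> \<noteq> \<tau>"
        unfolding fibre[symmetric] using * by (auto simp: psi_def)
      then show False by simp
    qed
    then show "psi n \<sigma> = t \<and> chain t" using fibre by blast
  next
    assume "psi n \<sigma> = t \<and> chain t"
    then show "{\<tau>\<in>Sym n. psi n \<tau> = t} = {\<sigma>}"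
      using chain_seq \<sigma> seq_inj by fastforce
  qed
  have cd: "psi n \<sigma> = t \<and> chain t \<longleftrightarrow> psi n \<sigma> = t \<and> max_at_end n (seq n \<sigma>)"
    using chain_leveled_tree_iff_max_at_end[OF seq_arrangement[OF \<sigma>]] by (auto simp: psi_def)
  show "(M_perm pos \<sigma> = M_tree pos t \<longleftrightarrow> {\<tau>\<in>Sym n. psi n \<tau> = t} = {\<sigma>}) \<and>
      ({\<tau>\<in>Sym n. psi n \<tau> = t} = {\<sigma>} \<longleftrightarrow>
        psi n \<sigma> = t \<and> (\<forall>i\<in>{1..n}. left_leaves t i = 1 \<or> right_leaves t i = 1)) \<and>
      (psi n \<sigma> = t \<and> (\<forall>i\<in>{1..n}. left_leaves t i = 1 \<or> right_leaves t i = 1) \<longleftrightarrow>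
        psi n \<sigma> = t \<and> max_at_end n (seq n \<sigma>))"
    unfolding leaves using ac bc cd by blast
qed

end
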